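(* There exists a set $L \subseteq \Sigma^\ast$ (with $\Sigma=\{0,1\}$) such that no set in the 1-truth-table degree of $L$ is retraceable; indeed, no set in the 1-truth-table upward cone $\{L' \subseteq \Sigma^\ast \mid L \leq_{1\text{-}tt} L'\}$ of $L$ is retraceable.
   Context: All sets are subsets of $\Sigma^\ast$ with $\Sigma=\{0,1\}$. The lexicographic order on $\Sigma^\ast$ is the length-then-lexicographic order $\epsilon < 0 < 1 < 00 < 01 < \cdots$. $A \leq_{1\text{-}tt} B$ (recursive 1-truth-table reducibility) means $A$ is Turing reducible to $B$ via a recursive oracle machine that halts on every input and makes at most one query to its oracle; the 1-truth-table degree of $L$ is $\{L' \mid L \leq_{1\text{-}tt} L' \text{ and } L' \leq_{1\text{-}tt} L\}$. A set $A$ is retraceable if there exist an enumeration $a_0, a_1, a_2, \ldots$ of $A$ without repetitions that lists the elements of $A$ in increasing lexicographic order (the enumeration need not be recursive), and a partial recursive function $f$ such that $f(a_0)=a_0$ and $f(a_{n+1}) = a_n$ for all $n$. *)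

theory Defs
  imports Main "HOL-Library.List_Lenlexorder" "HOL-Library.Extended_Nat"
begin

text \<open>
  Words over \<open>{0,1}\<close> are Boolean lists, with \<^const>\<open>False\<close> for \<open>0\<close> and \<^const>\<open>True\<close> for \<open>1\<close>.
  The imported instance of \<open><\<close> on lists is the length-then-lexicographic order.
\<close>

type_synonym word = "bool list"

text \<open>
  Oracle machines are Shepherdson--Sturgis register machines with word registers
  (a finite control working on finitely many stacks), extended by an oracle instruction.
  \<^item> \<open>Push r b\<close> puts \<open>b\<close> in front of register \<open>r\<close> and proceeds to the next instruction.
  \<^item> \<open>Pop r i j e\<close> removes the first bit of register \<open>r\<close> and jumps to \<open>i\<close> if it was \<open>0\<close>
    and to \<open>j\<close> if it was \<open>1\<close>; if the register is empty it jumps to \<open>e\<close>.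
  \<^item> \<open>Query r i j\<close> asks the oracle about the word in register \<open>r\<close> and jumps to \<open>i\<close> if the
    answer is yes and to \<open>j\<close> if it is no.
\<close>

datatype instr =
    Push nat bool
  | Pop nat nat nat nat
  | Query nat nat nat

type_synonym machine = "instr list"

text \<open>A configuration consists of the program counter, the registers and the number of
  oracle queries made so far. The machine has halted once the program counter lies outside
  the program.\<close>

type_synonym config = "nat \<times> (nat \<Rightarrow> word) \<times> nat"

fun step :: "machine \<Rightarrow> word set \<Rightarrow> config \<Rightarrow> config" where
  "step p B (pc, s, q) =
    (if pc < length p then
       (case p ! pc of
          Push r b \<Rightarrow> (Suc pc, s(r := b # s r), q)
        | Pop r i j e \<Rightarrow>
            (case s r of
               [] \<Rightarrow> (e, s, q)
             | b # w \<Rightarrow> (if b then j else i, s(r := w), q))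
        | Query r i j \<Rightarrow> (if s r \<in> B then i else j, s, Suc q))
     else (pc, s, q))"

definition initial :: "word \<Rightarrow> config" where
  "initial x = (0, (\<lambda>_. [])(0 := x), 0)"

text \<open>\<open>halts_with p B x y q\<close>: with oracle \<open>B\<close> and input \<open>x\<close>, the machine \<open>p\<close> halts with
  output \<open>y\<close> (in register \<open>0\<close>) having made exactly \<open>q\<close> queries.\<close>

definition halts_with :: "machine \<Rightarrow> word set \<Rightarrow> word \<Rightarrow> word \<Rightarrow> nat \<Rightarrow> bool" where
  "halts_with p B x y q \<longleftrightarrow>
    (\<exists>n pc s. (step p B ^^ n) (initial x) = (pc, s, q) \<and> length p \<le> pc \<and> s 0 = y)"

definition oracle_free :: "machine \<Rightarrow> bool" where
  "oracle_free p \<longleftrightarrow> (\<forall>r i j. Query r i j \<notin> set p)"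

text \<open>The oracle \<open>{}\<close> below is a dummy, since the machine makes no queries.\<close>

definition partial_recursive :: "(word \<Rightarrow> word option) \<Rightarrow> bool" where
  "partial_recursive f \<longleftrightarrow>
    (\<exists>p. oracle_free p \<and> (\<forall>x y. f x = Some y \<longleftrightarrow> (\<exists>q. halts_with p {} x y q)))"

text \<open>As usual for truth-table reductions, halting on every input with at most one query is
  a requirement on the machine itself, that is, it holds for every oracle \<open>C\<close>.
  The one-bit output \<open>[x \<in> A]\<close> is the value of the characteristic function of \<open>A\<close> at \<open>x\<close>.\<close>

definition one_tt_reducible :: "word set \<Rightarrow> word set \<Rightarrow> bool"  (infix \<open>\<le>\<^sub>1\<^sub>t\<^sub>t\<close> 50) where
  "A \<le>\<^sub>1\<^sub>t\<^sub>t B \<longleftrightarrow>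
    (\<exists>p. (\<forall>C x. \<exists>y q. halts_with p C x y q \<and> q \<le> 1) \<and>
         (\<forall>x. \<exists>q. halts_with p B x [x \<in> A] q))"

definition one_tt_degree :: "word set \<Rightarrow> word set set" where
  "one_tt_degree L = {L'. L \<le>\<^sub>1\<^sub>t\<^sub>t L' \<and> L' \<le>\<^sub>1\<^sub>t\<^sub>t L}"

definition one_tt_cone :: "word set \<Rightarrow> word set set" where
  "one_tt_cone L = {L'. L \<le>\<^sub>1\<^sub>t\<^sub>t L'}"

text \<open>The increasing enumeration \<open>a 0, a 1, \<dots>\<close> of \<open>A\<close> has length \<open>N\<close>, which is \<open>\<infinity>\<close>
  for infinite \<open>A\<close>. Finite sets are admitted, and the enumeration is then finite.\<close>

definition retraceable :: "word set \<Rightarrow> bool" where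
  "retraceable A \<longleftrightarrow>
    (\<exists>(N :: enat) (a :: nat \<Rightarrow> word) f.
       strict_mono_on {n. enat n < N} a \<and>
       a ` {n. enat n < N} = A \<and>
       partial_recursive f \<and>
       (0 < N \<longrightarrow> f (a 0) = Some (a 0)) \<and>
       (\<forall>n. enat (Suc n) < N \<longrightarrow> f (a (Suc n)) = Some (a n)))"

end

theory Submission imports Defs "HOL-Library.Countable_Set" begin

text \<open>
  If \<open>f\<close> retraces \<open>A\<close>, then \<open>A\<close> below any of its elements \<open>v\<close> is the orbit of \<open>v\<close> under \<open>f\<close>.
  So for \<open>u < v\<close> the function \<open>f\<close> alone decides that either \<open>v \<in> A\<close> forces \<open>u \<in> A\<close> or \<open>u\<close> and
  \<open>v\<close> are not both in \<open>A\<close>: one of the four patterns for \<open>(u \<in> A, v \<in> A)\<close> is excluded.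
  Reducing \<open>L\<close> to \<open>A\<close> with one query per input, by a fixed machine, transfers this to \<open>L\<close>:
  for any two inputs \<open>x \<noteq> y\<close>, some pattern for \<open>(x \<in> L, y \<in> L)\<close> is excluded.
  Only countably many pairs of a machine and a retracing function exist, so \<open>L\<close> can realise on a
  separate pair of inputs the pattern that each of them excludes.
\<close>

section \<open>Diagonalisation over countably many classes of sets\<close>

text \<open>Each class gets a private pair of points. These pairs are disjoint, so one
  \<open>L\<close> can realise on all of them at once the patterns that the respective classes
  exclude.\<close>

lemma diagonal_two_points:
  fixes F :: "'a set set set"
  assumes "countable F" and "infinite (UNIV :: 'a set)"
    and excl: "\<And>\<L> x y. \<L> \<in> F \<Longrightarrow> x \<noteq> y \<Longrightarrow> \<exists>b c. \<forall>L\<in>\<L>. \<not> ((x \<in> L) = b \<and> (y \<in> L) = c)"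
  shows "\<exists>L. \<forall>\<L>\<in>F. L \<notin> \<L>"
proof -
  obtain w :: "nat \<Rightarrow> 'a" where w: "inj w"
    using assms(2) infinite_countable_subset by blast
  define e where "e = to_nat_on F"
  have e: "inj_on e F"
    using assms(1) unfolding e_def by (rule inj_on_to_nat_on)
  define X where "X \<L> = w (2 * e \<L>)" for \<L>
  define Y where "Y \<L> = w (2 * e \<L> + 1)" for \<L>
  have odd_even: "2 * m \<noteq> Suc (2 * n)" "Suc (2 * n) \<noteq> 2 * m" for m n :: nat
    by presburger+
  \<comment> \<open>Parity separates \<open>X\<close> from \<open>Y\<close> for all arguments;
    \<open>XX\<close> needs membership in \<open>F\<close>, where \<open>e\<close> is
    injective.\<close>
  have XY: "X \<L> \<noteq> Y \<M>" "Y \<L> \<noteq> X \<M>" for \<L> \<M>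
    using w by (auto simp: X_def Y_def inj_eq odd_even)
  have XX: "X \<L> = X \<M> \<longleftrightarrow> \<L> = \<M>" "Y \<L> = Y \<M> \<longleftrightarrow> \<L> = \<M>" if "\<L> \<in> F" "\<M> \<in> F" for \<L> \<M>
    using w e that by (auto simp: X_def Y_def inj_eq inj_on_eq_iff)
  have "\<forall>\<L>\<in>F. \<exists>b c. \<forall>L\<in>\<L>. \<not> ((X \<L> \<in> L) = b \<and> (Y \<L> \<in> L) = c)"
    by (intro ballI excl XY)
  then obtain b c where bc: "\<forall>\<L>\<in>F. \<forall>L\<in>\<L>. \<not> ((X \<L> \<in> L) = b \<L> \<and> (Y \<L> \<in> L) = c \<L>)"
    unfolding bchoice_iff by (elim exE)
  define L where "L = X ` {\<L>\<in>F. b \<L>} \<union> Y ` {\<L>\<in>F. c \<L>}"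
  have "(X \<L> \<in> L) = b \<L>" "(Y \<L> \<in> L) = c \<L>" if "\<L> \<in> F" for \<L>
    using that XY XX by (auto simp: L_def)
  with bc show ?thesis
    by blast
qed

section \<open>Retracing functions and their orbits\<close>

definition retraces :: "(word \<Rightarrow> word option) \<Rightarrow> word set \<Rightarrow> bool" where
  "retraces f A \<longleftrightarrow>
    (\<exists>(N :: enat) (a :: nat \<Rightarrow> word).
       strict_mono_on {n. enat n < N} a \<and>
       a ` {n. enat n < N} = A \<and>
       (0 < N \<longrightarrow> f (a 0) = Some (a 0)) \<and>
       (\<forall>n. enat (Suc n) < N \<longrightarrow> f (a (Suc n)) = Some (a n)))"

lemma retraceable_iff: "retraceable A \<longleftrightarrow> (\<exists>f. partial_recursive f \<and> retraces f A)"
  unfolding retraceable_def retraces_def by blast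

definition orbit :: "('a \<Rightarrow> 'a option) \<Rightarrow> 'a \<Rightarrow> 'a set" where
  "orbit f v = {u. \<exists>k. ((\<lambda>z. Option.bind z f) ^^ k) (Some v) = Some u}"

text \<open>Each application of \<open>f\<close> moves one place down the enumeration and stops at
  \<open>a 0\<close>, so the iterates of \<open>f\<close> on \<open>a n\<close> are
  \<open>a n, ..., a 0\<close> and then \<open>a 0\<close> forever.\<close>

lemma retraces_orbit:
  assumes "retraces f A" and "v \<in> A"
  shows "orbit f v = {u \<in> A. u \<le> v}"
proof -
  obtain N a where mono: "strict_mono_on {n. enat n < N} a"
    and A: "a ` {n. enat n < N} = A"
    and f0: "0 < N \<longrightarrow> f (a 0) = Some (a 0)"
    and fS: "\<forall>n. enat (Suc n) < N \<longrightarrow> f (a (Suc n)) = Some (a n)"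
    using assms(1) unfolding retraces_def by blast
  obtain n where n: "enat n < N" "v = a n"
    using assms(2) A by blast
  have below: "enat m < N" if "m \<le> n" for m
    using n(1) that by (meson enat_ord_simps(1) le_less_trans)
  \<comment> \<open>Truncated subtraction makes \<open>m = 0\<close> the fixed point
    \<open>f (a 0) = Some (a 0)\<close>.\<close>
  have fa: "f (a m) = Some (a (m - 1))" if "m \<le> n" for m
    using f0 fS below[OF that] by (cases m) (auto simp: zero_enat_def)
  have iter: "((\<lambda>z. Option.bind z f) ^^ k) (Some v) = Some (a (n - k))" for k
    by (induction k) (auto simp: n(2) fa)
  have le: "a i \<le> a j \<longleftrightarrow> i \<le> j" if "enat i < N" "enat j < N" for i j
    using strict_mono_on_less_eq[OF mono] that by simp
  show ?thesis
  proof (intro equalityI subsetI)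
    fix u assume "u \<in> orbit f v"
    then obtain k where "u = a (n - k)"
      by (auto simp: orbit_def iter)
    then show "u \<in> {u \<in> A. u \<le> v}"
      using A n le below[of "n - k"] by auto
  next
    fix u assume "u \<in> {u \<in> A. u \<le> v}"
    then obtain m where "enat m < N" "u = a m" "a m \<le> a n"
      using A n by auto
    then have "m \<le> n" "u = a m"
      using le n by auto
    then have "u = a (n - (n - m))"
      by simp
    then show "u \<in> orbit f v"
      unfolding orbit_def iter by blast
  qed
qed

text \<open>The quantifier order matters: the pattern depends on \<open>f\<close>, \<open>u\<close>
  and \<open>v\<close> only. The orbit of the larger word predicts whether the smaller one is in
  \<open>A\<close>, and the excluded pattern contradicts this prediction.\<close>

lemma retraces_excluded_pattern:
  "\<exists>b c. \<forall>A. retraces f A \<longrightarrow> \<not> ((u \<in> A) = b \<and> (v \<in> A) = c)"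
proof -
  have *: "\<not> ((u \<in> A) = (u \<notin> orbit f v) \<and> (v \<in> A) = True)"
    if "u < v" "retraces f A" for u v A
  proof -
    have "u \<in> orbit f v \<longleftrightarrow> u \<in> A" if "v \<in> A"
      using \<open>u < v\<close> by (simp add: retraces_orbit[OF \<open>retraces f A\<close> that] less_imp_le)
    then show ?thesis by blast
  qed
  consider "u < v" | "v < u" | "u = v"
    by (rule linorder_cases)
  then show ?thesis
  proof cases
    case 1
    with * show ?thesis
      by (intro exI[of _ "u \<notin> orbit f v"] exI[of _ True]) blast
  next
    case 2
    with * show ?thesis
      by (intro exI[of _ True] exI[of _ "v \<notin> orbit f u"]) blast
  next
    case 3
    then show ?thesis
      by (intro exI[of _ True] exI[of _ False]) simp
  qed
qed

section \<open>Runs of oracle machines and their queries\<close>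

fun query :: "machine \<Rightarrow> config \<Rightarrow> word option" where
  "query p (pc, s, q) =
    (if pc < length p then (case p ! pc of Query r i j \<Rightarrow> Some (s r) | _ \<Rightarrow> None) else None)"

definition run :: "machine \<Rightarrow> word set \<Rightarrow> word \<Rightarrow> nat \<Rightarrow> config" where
  "run p B x n = (step p B ^^ n) (initial x)"

lemma run_0 [simp]: "run p B x 0 = initial x"
  by (simp add: run_def)

lemma run_Suc [simp]: "run p B x (Suc n) = step p B (run p B x n)"
  by (simp add: run_def)

lemma step_cong_query:
  assumes "\<And>u. query p c = Some u \<Longrightarrow> u \<in> B \<longleftrightarrow> u \<in> C"
  shows "step p B c = step p C c"
  using assms by (cases c) (auto split: instr.splits list.splits if_splits)

text \<open>Agreement is required only on words queried along the run with \<open>B\<close>; by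
  induction the run with \<open>C\<close> then asks the same ones.\<close>

lemma run_cong_query:
  assumes "\<And>m u. m < n \<Longrightarrow> query p (run p B x m) = Some u \<Longrightarrow> u \<in> B \<longleftrightarrow> u \<in> C"
  shows "run p C x n = run p B x n"
  using assms
proof (induction n)
  case (Suc n)
  have "run p C x n = run p B x n"
    by (rule Suc.IH) (use Suc.prems less_SucI in blast)
  moreover have "step p B (run p B x n) = step p C (run p B x n)"
    using Suc.prems by (intro step_cong_query) blast
  ultimately show ?case
    by simp
qed simp

abbreviation query_count :: "config \<Rightarrow> nat" where
  "query_count c \<equiv> snd (snd c)"

lemma query_count_step:
  "query_count (step p B c) = query_count c + (if query p c = None then 0 else 1)"
  by (cases c) (auto split: instr.splits list.splits)

lemma query_count_run_mono: "m \<le> n \<Longrightarrow> query_count (run p B x m) \<le> query_count (run p B x n)"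
  by (induction n rule: dec_induct) (simp_all add: query_count_step)

lemma run_halted:
  assumes "run p B x n = (pc, s, q)" "length p \<le> pc" "n \<le> m"
  shows "run p B x m = (pc, s, q)"
  using assms(3,1,2) by (induction m rule: dec_induct) simp_all

lemma halts_with_run:
  "halts_with p B x y q \<longleftrightarrow> (\<exists>n pc s. run p B x n = (pc, s, q) \<and> length p \<le> pc \<and> s 0 = y)"
  by (simp add: halts_with_def run_def)

lemma halts_with_unique:
  assumes "halts_with p B x y q" and "halts_with p B x y' q'"
  shows "y = y'"
proof -
  obtain n pc s n' pc' s' where
    1: "run p B x n = (pc, s, q)" "length p \<le> pc" "s 0 = y" and
    2: "run p B x n' = (pc', s', q')" "length p \<le> pc'" "s' 0 = y'"
    using assms unfolding halts_with_run by blast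
  have "(pc, s, q) = (pc', s', q')"
    using run_halted[OF 1(1,2), of "max n n'"] run_halted[OF 2(1,2), of "max n n'"] by simp
  with 1 2 show ?thesis by simp
qed

lemma query_count_run_le:
  assumes "halts_with p B x y q"
  shows "query_count (run p B x m) \<le> q"
proof -
  obtain n pc s where n: "run p B x n = (pc, s, q)" "length p \<le> pc"
    using assms unfolding halts_with_run by blast
  have "query_count (run p B x m) \<le> query_count (run p B x (max m n))"
    by (rule query_count_run_mono) simp
  also have "run p B x (max m n) = (pc, s, q)"
    using n by (rule run_halted) simp
  finally show ?thesis by simp
qed

text \<open>The first query does not depend on the oracle, as nothing has been answered before it.\<close>

lemma single_query_word:
  assumes "\<And>C. \<exists>y q. halts_with p C x y q \<and> q \<le> 1"
  shows "\<exists>u. \<forall>B C. (u \<in> B \<longleftrightarrow> u \<in> C) \<longrightarrow> halts_with p B x = halts_with p C x"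
proof -
  have "\<exists>u. \<forall>C n v. query p (run p C x n) = Some v \<longrightarrow> v = u"
  proof (cases "\<forall>C n. query p (run p C x n) = None")
    case False
    \<comment> \<open>The run with oracle \<open>{}\<close> serves as reference: every other run
      coincides with it up to its first query.\<close>
    define P where "P n \<longleftrightarrow> query p (run p {} x n) \<noteq> None" for n
    have "\<exists>n. P n"
    proof (rule ccontr)
      assume "\<nexists>n. P n"
      then have none: "query p (run p {} x n) = None" for n
        by (simp add: P_def)
      then have "run p C x n = run p {} x n" for C n
        by (intro run_cong_query) simp
      with none have "query p (run p C x n) = None" for C n
        by metis
      with False show False
        by blast
    qed
    then obtain m where m: "P m" "\<And>k. k < m \<Longrightarrow> \<not> P k"
      using exists_least_iff[of P] by blast
    obtain u where u: "query p (run p {} x m) = Some u"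
      using m(1) by (auto simp: P_def)
    have same: "run p C x k = run p {} x k" if "k \<le> m" for C k
      using that m(2) by (intro run_cong_query) (simp add: P_def)
    have "v = u" if v: "query p (run p C x n) = Some v" for C n v
    proof (cases n m rule: linorder_cases)
      case less
      then show ?thesis
        using v m(2)[of n] same[of n C] by (simp add: P_def)
    next
      case equal
      then show ?thesis
        using v u same[of m C] by simp
    next
      case greater
      \<comment> \<open>A query at time \<open>n > m\<close> would be the second one, exceeding the
        bound.\<close>
      have "1 \<le> query_count (run p C x (Suc m))"
        using u same[of m C] by (simp add: query_count_step)
      also have "\<dots> \<le> query_count (run p C x n)"
        using greater by (intro query_count_run_mono) simp
      finally have "2 \<le> query_count (run p C x (Suc n))"
        using v by (simp add: query_count_step)
      moreover obtain y q where "halts_with p C x y q" "q \<le> 1"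
        using assms by blast
      then have "query_count (run p C x (Suc n)) \<le> 1"
        using query_count_run_le le_trans by blast
      ultimately show ?thesis by simp
    qed
    then show ?thesis by blast
  qed simp
  then obtain u where u: "\<And>C n v. query p (run p C x n) = Some v \<Longrightarrow> v = u"
    by blast
  have "halts_with p B x = halts_with p C x" if "u \<in> B \<longleftrightarrow> u \<in> C" for B C
  proof -
    have "run p B x n = run p C x n" for n
      using u that by (intro run_cong_query) blast
    then show ?thesis
      by (intro ext) (simp add: halts_with_run)
  qed
  then show ?thesis by blast
qed

text \<open>At a fixed input the oracle matters only through its answer on one word, so a Boolean
  function of that answer gives every one-bit output.\<close>

lemma single_query_decision:
  assumes "\<And>C. \<exists>y q. halts_with p C x y q \<and> q \<le> 1"
  shows "\<exists>u h. \<forall>B b q. halts_with p B x [b] q \<longrightarrow> b = h (u \<in> B)"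
proof -
  obtain u where u: "\<And>B C. (u \<in> B \<longleftrightarrow> u \<in> C) \<Longrightarrow> halts_with p B x = halts_with p C x"
    using single_query_word[OF assms] by blast
  \<comment> \<open>Any oracle with answer \<open>d\<close> may serve as witness, since all of them
    give the same result at \<open>x\<close>.\<close>
  define h where "h d \<longleftrightarrow> (\<exists>B q. (u \<in> B) = d \<and> halts_with p B x [True] q)" for d
  have "b = h (u \<in> B)" if b: "halts_with p B x [b] q" for B b q
  proof (cases b)
    case True
    then show ?thesis using b by (auto simp: h_def)
  next
    case False
    have "\<not> h (u \<in> B)"
    proof
      assume "h (u \<in> B)"
      then obtain C q' where "(u \<in> C) = (u \<in> B)" "halts_with p C x [True] q'"
        by (auto simp: h_def)
      then have "halts_with p B x [True] q'"
        using u[of C B] by simp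
      with b False show False
        using halts_with_unique by blast
    qed
    with False show ?thesis by simp
  qed
  then show ?thesis by blast
qed

section \<open>Transfer of excluded patterns along reductions\<close>

definition one_tt_machine :: "machine \<Rightarrow> bool" where
  "one_tt_machine p \<longleftrightarrow> (\<forall>C x. \<exists>y q. halts_with p C x y q \<and> q \<le> 1)"

text \<open>Only \<open>p\<close> and \<open>f\<close> are parameters while \<open>A\<close> is
  quantified inside, which leaves countably many classes to avoid.\<close>

definition reduced_to_retraced :: "machine \<Rightarrow> (word \<Rightarrow> word option) \<Rightarrow> word set set" where
  "reduced_to_retraced p f = {L. \<exists>A. retraces f A \<and> (\<forall>x. \<exists>q. halts_with p A x [x \<in> L] q)}"

lemma reduced_to_retraced_excluded_pattern:
  assumes "one_tt_machine p"
  shows "\<exists>b c. \<forall>L\<in>reduced_to_retraced p f. \<not> ((x \<in> L) = b \<and> (y \<in> L) = c)"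
proof -
  obtain u h where h: "\<And>B b q. halts_with p B x [b] q \<Longrightarrow> b = h (u \<in> B)"
    using single_query_decision[of p x] assms unfolding one_tt_machine_def by blast
  obtain v k where k: "\<And>B b q. halts_with p B y [b] q \<Longrightarrow> b = k (v \<in> B)"
    using single_query_decision[of p y] assms unfolding one_tt_machine_def by blast
  obtain d e where de: "\<And>A. retraces f A \<Longrightarrow> \<not> ((u \<in> A) = d \<and> (v \<in> A) = e)"
    using retraces_excluded_pattern by blast
  \<comment> \<open>no value but \<open>d\<close> can be mapped to \<open>\<not> h (\<not> d)\<close> by \<open>h\<close>, even if \<open>h\<close> is constant\<close>
  define b c where "b = (\<not> h (\<not> d))" and "c = (\<not> k (\<not> e))"
  have bc: "h d' = b \<Longrightarrow> d' = d" "k e' = c \<Longrightarrow> e' = e" for d' e'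
    unfolding b_def c_def by (cases "d' = d"; cases "e' = e"; simp)+
  have "\<not> ((x \<in> L) = b \<and> (y \<in> L) = c)" if L: "L \<in> reduced_to_retraced p f" for L
  proof -
    obtain A where A: "retraces f A" "\<forall>z. \<exists>q. halts_with p A z [z \<in> L] q"
      using L unfolding reduced_to_retraced_def by blast
    have "(x \<in> L) = h (u \<in> A)" "(y \<in> L) = k (v \<in> A)"
      using A(2) h k by blast+
    with bc de[OF A(1)] show ?thesis by blast
  qed
  then show ?thesis by blast
qed

section \<open>Countability and the final diagonalisation\<close>

instance instr :: countable
  by countable_datatype

text \<open>A machine determines the function it computes, so choosing a machine for each function
  is injective into a countable type.\<close>

lemma countable_partial_recursive: "countable {f. partial_recursive f}"
proof -
  define M where "M f p \<longleftrightarrow> (\<forall>x y. f x = Some y \<longleftrightarrow> (\<exists>q. halts_with p {} x y q))" for f p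
  have "inj_on (\<lambda>f. SOME p. M f p) {f. partial_recursive f}"
  proof (rule inj_onI)
    fix f g assume "f \<in> {f. partial_recursive f}" "g \<in> {f. partial_recursive f}"
      and eq: "(SOME p. M f p) = (SOME p. M g p)"
    then have "\<exists>p. M f p" "\<exists>p. M g p"
      unfolding M_def partial_recursive_def by blast+
    then have "M f (SOME p. M f p)" "M g (SOME p. M g p)"
      by - (erule someI_ex)+
    then obtain p where "M f p" "M g p"
      unfolding eq by blast
    then have iff: "f x = Some y \<longleftrightarrow> g x = Some y" for x y
      unfolding M_def by blast
    show "f = g"
    proof
      show "f x = g x" for x
        using iff by (metis not_None_eq)
    qed
  qed
  then show ?thesis
    by (rule countableI')
qed

theorem theorem1:
  "\<exists>L :: word set.
     (\<forall>L' \<in> one_tt_degree L. \<not> retraceable L') \<and>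
     (\<forall>L' \<in> one_tt_cone L. \<not> retraceable L')"
proof -
  define F where "F = (\<lambda>(p, f). reduced_to_retraced p f) ` ({p. one_tt_machine p} \<times> {f. partial_recursive f})"
  have "\<exists>L. \<forall>\<L>\<in>F. L \<notin> \<L>"
  proof (rule diagonal_two_points)
    show "countable F"
      unfolding F_def by (intro countable_image countable_SIGMA countable_partial_recursive) auto
    show "infinite (UNIV :: word set)"
      by (rule infinite_UNIV_listI)
    show "\<exists>b c. \<forall>L\<in>\<L>. \<not> ((x \<in> L) = b \<and> (y \<in> L) = c)" if "\<L> \<in> F" for \<L> x y
    proof -
      obtain p f where "one_tt_machine p" "\<L> = reduced_to_retraced p f"
        using \<open>\<L> \<in> F\<close> unfolding F_def by auto
      then show ?thesis
        using reduced_to_retraced_excluded_pattern by simp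
    qed
  qed
  then obtain L where L: "\<And>\<L>. \<L> \<in> F \<Longrightarrow> L \<notin> \<L>"
    by blast
  \<comment> \<open>The degree of \<open>L\<close> lies inside its cone, so this settles both
    claims.\<close>
  have "\<not> retraceable A" if "L \<le>\<^sub>1\<^sub>t\<^sub>t A" for A
  proof
    assume "retraceable A"
    then obtain f where f: "partial_recursive f" "retraces f A"
      unfolding retraceable_iff by blast
    from that obtain p where p: "one_tt_machine p" "\<forall>x. \<exists>q. halts_with p A x [x \<in> L] q"
      unfolding one_tt_reducible_def one_tt_machine_def by blast
    then have "L \<in> reduced_to_retraced p f"
      using f(2) unfolding reduced_to_retraced_def by blast
    moreover have "reduced_to_retraced p f \<in> F"
      using f(1) p(1) unfolding F_def by auto
    ultimately show False
      using L by blast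
  qed
  then show ?thesis
    unfolding one_tt_degree_def one_tt_cone_def by blast
qed

end
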